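(* Let $\boldsymbol A\in\mathbb{R}^{M\times N}$ be the design matrix, $\boldsymbol b\in\mathbb{R}^M$ the data vector and $C\subset\mathbb{R}^N$ the feasible set defined in the context. Assume that $\boldsymbol A$ has rank $N$ and that $C$ is nonempty. Then the constrained optimization problem $$\min_{\widehat{\boldsymbol v}\in C}\ \|\boldsymbol A\widehat{\boldsymbol v}-\boldsymbol b\|_2^2$$ has a unique solution, i.e. there is exactly one minimizer $\widehat{\boldsymbol v}\in C$.
   Context: Let $\Omega\subset\mathbb{R}^d$ ($d\ge 1$), and let $H$ be a real Hilbert space of scalar-valued functions on $\Omega$ with inner product $\langle\cdot,\cdot\rangle$. Let $V\subset H$ be an $N$-dimensional subspace with orthonormal basis $v_1,\dots,v_N$, and let $V^\ast$ be its dual, with the operator norm. Data: $\phi_1,\dots,\phi_M$ are linear functionals on $H$ that are bounded on $V$, $u\in H$, and the observations $\phi_j(u)\in\mathbb{R}$ are given. The matrix $\boldsymbol A\in\mathbb{R}^{M\times N}$ has entries $(A)_{m,n}=\phi_m(v_n)$, and $\boldsymbol b\in\mathbb{R}^M$ has entries $b_j=\phi_j(u)$. Constraints: for $k=1,\dots,K$ a constraint family is a tuple $(L_k,r_k,\omega_k)$, where $\omega_k\subset\Omega$, $r_k\in V$, and for each $y\in\omega_k$, $L_k(\cdot,y)$ is an element of $V^\ast$ of unit norm. Define $$E_k=\{v\in V : L_k(v,y)\le L_k(r_k,y)\text{ for all }y\in\omega_k\},$$ $$C_k=\Big\{\boldsymbol c\in\mathbb{R}^N : \sum_{j=1}^N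 c_jv_j\in E_k\Big\},\qquad C=\bigcap_{k=1}^K C_k .$$ $\|\cdot\|_2$ is the Euclidean norm. *)

theory Defs
  imports "HOL-Analysis.Analysis"
begin

text \<open>
  A real Hilbert space of real-valued functions on \<open>\<Omega>\<close> is modelled by a type
  \<open>'h :: {real_inner, complete_space}\<close> whose elements are identified with functions through an
  evaluation map \<open>ev\<close>: the vector space operations are pointwise on \<open>\<Omega>\<close>, and elements agreeing
  on all of \<open>\<Omega>\<close> are equal. Values of \<open>ev f\<close> outside \<open>\<Omega>\<close> are irrelevant.
\<close>

definition function_space_on :: "'x set \<Rightarrow> ('h::real_vector \<Rightarrow> 'x \<Rightarrow> real) \<Rightarrow> bool" where
  "function_space_on \<Omega> ev \<longleftrightarrow>
     (\<forall>x\<in>\<Omega>. linear (\<lambda>f. ev f x)) \<and> (\<forall>f g. (\<forall>x\<in>\<Omega>. ev f x = ev g x) \<longrightarrow> f = g)"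

definition orthonormal_basis :: "('n \<Rightarrow> 'h::real_inner) \<Rightarrow> 'h set \<Rightarrow> bool" where
  "orthonormal_basis v V \<longleftrightarrow>
     (\<forall>i j. v i \<bullet> v j = (if i = j then 1 else 0)) \<and> span (range v) = V"

definition bounded_on :: "'h::real_normed_vector set \<Rightarrow> ('h \<Rightarrow> real) \<Rightarrow> bool" where
  "bounded_on V f \<longleftrightarrow> (\<exists>B. \<forall>x\<in>V. \<bar>f x\<bar> \<le> B * norm x)"

text \<open>
  Elements of \<open>V\<^sup>*\<close> are represented by functions on the ambient type; only their values
  on \<open>V\<close> are constrained.
\<close>

definition dual_space :: "'h::real_normed_vector set \<Rightarrow> ('h \<Rightarrow> real) set" where
  "dual_space V =
     {f. (\<forall>x\<in>V. \<forall>y\<in>V. f (x + y) = f x + f y) \<and> (\<forall>a. \<forall>x\<in>V. f (a *\<^sub>R x) = a * f x) \<and>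
         bounded_on V f}"

text \<open>The operator norm over a subspace; the quotient is \<open>0\<close> at \<open>x = 0\<close>, as in \<open>onorm\<close>.\<close>

definition dual_norm :: "'h::real_normed_vector set \<Rightarrow> ('h \<Rightarrow> real) \<Rightarrow> real" where
  "dual_norm V f = (SUP x\<in>V. \<bar>f x\<bar> / norm x)"

lemma dual_norm_UNIV: "dual_norm UNIV f = onorm f"
  by (simp add: dual_norm_def onorm_def)

definition design_matrix :: "('m \<Rightarrow> 'h \<Rightarrow> real) \<Rightarrow> ('n \<Rightarrow> 'h) \<Rightarrow> real ^ 'n ^ 'm" where
  "design_matrix \<phi> v = (\<chi> m n. \<phi> m (v n))"

definition data_vector :: "('m \<Rightarrow> 'h \<Rightarrow> real) \<Rightarrow> 'h \<Rightarrow> real ^ 'm" where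
  "data_vector \<phi> u = (\<chi> j. \<phi> j u)"

definition constraint_set ::
    "'h set \<Rightarrow> ('h \<Rightarrow> 'x \<Rightarrow> real) \<Rightarrow> 'h \<Rightarrow> 'x set \<Rightarrow> 'h set" where
  "constraint_set V L r \<omega> = {w \<in> V. \<forall>y\<in>\<omega>. L w y \<le> L r y}"

definition coefficient_set ::
    "('n \<Rightarrow> 'h::real_vector) \<Rightarrow> 'h set \<Rightarrow> (real ^ 'n) set" where
  "coefficient_set v E = {c. (\<Sum>j\<in>UNIV. c $ j *\<^sub>R v j) \<in> E}"

definition feasible_set ::
    "'h::real_vector set \<Rightarrow> ('n \<Rightarrow> 'h) \<Rightarrow> nat \<Rightarrow> (nat \<Rightarrow> 'h \<Rightarrow> 'x \<Rightarrow> real) \<Rightarrow>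
     (nat \<Rightarrow> 'h) \<Rightarrow> (nat \<Rightarrow> 'x set) \<Rightarrow> (real ^ 'n) set" where
  "feasible_set V v K L r \<omega> =
     (\<Inter>k\<in>{1..K}. coefficient_set v (constraint_set V (L k) (r k) (\<omega> k)))"

end

theory Submission imports Defs
begin

text \<open>
  Minimising \<open>\<parallel>A c - b\<parallel>\<^sup>2\<close> over \<open>C\<close> means projecting \<open>b\<close> onto the image \<open>A C\<close>. In coordinates each
  constraint is linear in \<open>c\<close>, so \<open>C\<close> is an intersection of closed half-spaces and hence closed
  and convex (\<open>closed_convex_feasible_set\<close>). Full column rank makes \<open>A\<close> injective, which serves
  twice: a finite-dimensional injective linear map preserves closedness, so \<open>A C\<close> is closed and
  convex and contains exactly one point nearest to \<open>b\<close>; and this point has exactly one preimage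
  in \<open>C\<close> (\<open>unique_least_squares\<close>).
\<close>

lemma dual_space_sum:
  assumes "subspace V" and f: "f \<in> dual_space V" and "finite S"
    and "\<And>j. j \<in> S \<Longrightarrow> v j \<in> V"
  shows "f (\<Sum>j\<in>S. c j *\<^sub>R v j) = (\<Sum>j\<in>S. c j * f (v j))"
  using \<open>finite S\<close> assms(4)
proof (induction S rule: finite_induct)
  case empty
  have "f (0 *\<^sub>R 0) = 0 * f 0"
    using f subspace_0[OF \<open>subspace V\<close>] unfolding dual_space_def by blast
  then show ?case by simp
next
  case (insert i S)
  have "c i *\<^sub>R v i \<in> V" "(\<Sum>j\<in>S. c j *\<^sub>R v j) \<in> V"
    using insert.prems \<open>subspace V\<close> by (auto intro!: subspace_sum subspace_scale)
  moreover have "v i \<in> V"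
    using insert.prems by simp
  ultimately show ?case
    using f insert by (simp add: dual_space_def)
qed

text \<open>
  By linearity of \<open>L(\<cdot>, y)\<close> on \<open>V\<close>, its values at the vectors \<open>v j\<close> form the normal vector of a
  half-space in coefficient space, one for every \<open>y \<in> \<omega>\<close>.
\<close>

lemma coefficient_set_eq_halfspaces:
  fixes v :: "'n::finite \<Rightarrow> 'h::real_normed_vector"
  assumes "subspace V" and "\<And>j. v j \<in> V"
    and "\<And>y. y \<in> \<omega> \<Longrightarrow> (\<lambda>w. L w y) \<in> dual_space V"
  shows "coefficient_set v (constraint_set V L r \<omega>) =
    (\<Inter>y\<in>\<omega>. {c. (\<chi> j. L (v j) y) \<bullet> c \<le> L r y})"
proof -
  have "(\<Sum>j\<in>UNIV. c $ j *\<^sub>R v j) \<in> V" for c :: "real ^ 'n"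
    using assms(1,2) by (auto intro!: subspace_sum subspace_scale)
  moreover have "L (\<Sum>j\<in>UNIV. c $ j *\<^sub>R v j) y = (\<chi> j. L (v j) y) \<bullet> c" if "y \<in> \<omega>" for c y
    using dual_space_sum[OF assms(1) assms(3)[OF that], of UNIV v] assms(2)
    by (simp add: inner_vec_def mult.commute)
  ultimately show ?thesis
    by (auto simp: coefficient_set_def constraint_set_def)
qed

lemma closed_convex_feasible_set:
  fixes v :: "'n::finite \<Rightarrow> 'h::real_normed_vector"
  assumes "subspace V" and "\<And>j. v j \<in> V"
    and "\<And>k y. k \<in> {1..K} \<Longrightarrow> y \<in> \<omega> k \<Longrightarrow> (\<lambda>w. L k w y) \<in> dual_space V"
  shows "closed (feasible_set V v K L r \<omega>) \<and> convex (feasible_set V v K L r \<omega>)"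
proof -
  have "feasible_set V v K L r \<omega> =
      (\<Inter>k\<in>{1..K}. \<Inter>y\<in>\<omega> k. {c. (\<chi> j. L k (v j) y) \<bullet> c \<le> L k (r k) y})"
    unfolding feasible_set_def
    using assms by (intro INF_cong refl coefficient_set_eq_halfspaces) auto
  then show ?thesis
    by (auto intro!: closed_INT convex_INT closed_halfspace_le convex_halfspace_le)
qed

text \<open>
  The problem is transported to the data space, where it asks for the nearest point to \<open>b\<close> in \<open>A C\<close>.
\<close>

lemma unique_least_squares:
  fixes A :: "real ^ 'n ^ 'm"
  assumes inj: "inj ((*v) A)" and "closed C" and "convex C" and "C \<noteq> {}"
  shows "\<exists>!c. is_arg_min (\<lambda>c. (norm (A *v c - b))\<^sup>2) (\<lambda>c. c \<in> C) c"
proof -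
  define D where "D = (*v) A ` C"
  have D: "closed D" "convex D" "D \<noteq> {}"
    unfolding D_def using assms
    by (auto intro: closed_injective_linear_image convex_linear_image)
  have arg_min_iff: "is_arg_min (\<lambda>c. (norm (A *v c - b))\<^sup>2) (\<lambda>c. c \<in> C) c \<longleftrightarrow>
      c \<in> C \<and> (\<forall>z\<in>D. dist b (A *v c) \<le> dist b z)" for c
    by (auto simp: is_arg_min_linorder D_def dist_norm norm_minus_commute abs_le_square_iff[symmetric])
  obtain c where c: "c \<in> C" "A *v c = closest_point D b"
    using closest_point_in_set[OF D(1,3), of b] by (auto simp: D_def)
  show ?thesis
  proof (rule ex1I[of _ c])
    show "is_arg_min (\<lambda>c. (norm (A *v c - b))\<^sup>2) (\<lambda>c. c \<in> C) c"
      unfolding arg_min_iff using c closest_point_le[OF D(1)] by simp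
  next
    fix c' assume "is_arg_min (\<lambda>c. (norm (A *v c - b))\<^sup>2) (\<lambda>c. c \<in> C) c'"
    then have "A *v c' = closest_point D b"
      unfolding arg_min_iff using D by (intro closest_point_unique) (auto simp: D_def)
    with c(2) have "A *v c' = A *v c"
      by simp
    with inj show "c' = c"
      by (rule injD)
  qed
qed

theorem theorem3p2:
  fixes \<Omega> :: "(real ^ 'd) set"
    and ev :: "'h::{real_inner, complete_space} \<Rightarrow> real ^ 'd \<Rightarrow> real"
    and V :: "'h set"
    and v :: "'n::finite \<Rightarrow> 'h"
    and \<phi> :: "'m::finite \<Rightarrow> 'h \<Rightarrow> real"
    and u :: 'h
    and K :: nat
    and L :: "nat \<Rightarrow> 'h \<Rightarrow> real ^ 'd \<Rightarrow> real"
    and r :: "nat \<Rightarrow> 'h"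
    and \<omega> :: "nat \<Rightarrow> (real ^ 'd) set"
    and A :: "real ^ 'n ^ 'm"
    and b :: "real ^ 'm"
    and C :: "(real ^ 'n) set"
  assumes "function_space_on \<Omega> ev"
    and "subspace V" and "dim V = CARD('n)"
    and "orthonormal_basis v V"
    and "\<And>j. linear (\<phi> j)" and "\<And>j. bounded_on V (\<phi> j)"
    and "\<And>k. k \<in> {1..K} \<Longrightarrow> \<omega> k \<subseteq> \<Omega>"
    and "\<And>k. k \<in> {1..K} \<Longrightarrow> r k \<in> V"
    and "\<And>k y. k \<in> {1..K} \<Longrightarrow> y \<in> \<omega> k \<Longrightarrow> (\<lambda>w. L k w y) \<in> dual_space V"
    and "\<And>k y. k \<in> {1..K} \<Longrightarrow> y \<in> \<omega> k \<Longrightarrow> dual_norm V (\<lambda>w. L k w y) = 1"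
    and "A = design_matrix \<phi> v"
    and "b = data_vector \<phi> u"
    and "C = feasible_set V v K L r \<omega>"
    and "rank A = CARD('n)"
    and "C \<noteq> {}"
  shows "\<exists>!c. is_arg_min (\<lambda>c. (norm (A *v c - b))\<^sup>2) (\<lambda>c. c \<in> C) c"
proof -
  have "v j \<in> V" for j
    using assms(4) span_superset[of "range v"] by (auto simp: orthonormal_basis_def)
  then have "closed C \<and> convex C"
    unfolding assms(13) using assms(2,9) by (intro closed_convex_feasible_set)
  moreover have "inj ((*v) A)"
    using assms(14) full_rank_injective[of A] by simp
  ultimately show ?thesis
    using assms(15) by (intro unique_least_squares) auto
qed

end
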